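(* Consider $n$ agents in $\mathbb{R}^2$ with positions $p_1(k),\dots,p_n(k)$, $k=0,1,2,\dots$, visibility range $V>0$ and maximal step-size $\sigma>0$. At each time-step a random subset of agents is active, subject to the strong asynchronicity assumption stated in the context; each active agent $i$ moves to a uniformly distributed random point of its allowable region $$AR_i(k)=\Bigl(\bigcap_{j\in N_i(k)}D_{\frac V2}\bigl(c_{ij}(k)\bigr)\Bigr)\cap D_{\mu}\bigl(p_i(k)\bigr),\qquad \mu=\min\{\tfrac V2,\sigma\},$$ and inactive agents stay put. Then, for any initial constellation having a connected neighborhood graph, all agents gather to a disk of diameter $V$ in a finite expected number of time-steps, i.e. the first time-step $k$ at which all the positions $p_1(k),\dots,p_n(k)$ lie in a common disk of diameter $V$ has finite expectation.
   Context: System $\mathcal{S}_8$ (finite visibility, bearing-only sensing, discrete time, semi-synchronous). Agent $j\neq i$ is a neighbour of agent $i$ at time-step $k$, $j\in N_i(k)$, iff $\|p_i(k)-p_j(k)\|<V$; the neighborhood graph has the agents as vertices and pairs of neighbours as edges. $D_r(c)$ is the closed disc of radius $r$ centered at $c$, and $c_{ij}(k)=p_i(k)+\frac V2\frac{p_j(k)-p_i(k)}{\|p_j(k)-p_i(k)\|}$ (defined for $p_j(k)\ne p_i(k)$; collocated neighbours contribute no disc to the intersection). If the allowable region reduces to the single point $p_i(k)$, the agent stays put. Strong asynchronicity assumption: there exists a constant $\delta>0$ such that for any subset $S$ of agents, at each time-step $k$, the probability (given the past) that $S$ is exactly the set of active agents is at least $\delta$. *)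

theory Defs
  imports "HOL-Probability.Probability"
begin

type_synonym point = "real ^ 2"

definition neighbours :: "real \<Rightarrow> ('a \<Rightarrow> point) \<Rightarrow> 'a \<Rightarrow> 'a set" where
  "neighbours V x i = {j. j \<noteq> i \<and> norm (x i - x j) < V}"

definition neighbourhood_graph :: "real \<Rightarrow> ('a \<Rightarrow> point) \<Rightarrow> ('a \<times> 'a) set" where
  "neighbourhood_graph V x = {(i, j). j \<in> neighbours V x i}"

text \<open>The edge relation is symmetric, so its reflexive transitive closure expresses
  the existence of a path between two agents.\<close>

definition connected_constellation :: "real \<Rightarrow> ('a \<Rightarrow> point) \<Rightarrow> bool" where
  "connected_constellation V x \<longleftrightarrow> (\<forall>i j. (i, j) \<in> (neighbourhood_graph V x)\<^sup>*)"

definition disc_centre :: "real \<Rightarrow> point \<Rightarrow> point \<Rightarrow> point" where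
  "disc_centre V a b = a + (V / 2) *\<^sub>R ((b - a) /\<^sub>R norm (b - a))"

text \<open>Collocated neighbours have no bearing and contribute no disc; an intersection over no
  discs is the whole plane.\<close>

definition allowable_region :: "real \<Rightarrow> real \<Rightarrow> ('a \<Rightarrow> point) \<Rightarrow> 'a \<Rightarrow> point set" where
  "allowable_region V \<sigma> x i =
     (\<Inter>j\<in>{j \<in> neighbours V x i. x j \<noteq> x i}. cball (disc_centre V (x i) (x j)) (V / 2))
       \<inter> cball (x i) (min (V / 2) \<sigma>)"

text \<open>The region always contains \<open>x i\<close>. Each disc of the first family has \<open>x i\<close> on
  its boundary, so by strict convexity the region is either the singleton \<open>{x i}\<close> or has
  nonempty interior; hence the uniform distribution with respect to area is only
  used for a compact set of positive area.\<close>

definition step_distribution :: "real \<Rightarrow> real \<Rightarrow> ('a \<Rightarrow> point) \<Rightarrow> 'a \<Rightarrow> point measure" where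
  "step_distribution V \<sigma> x i =
     (if allowable_region V \<sigma> x i = {x i} then return borel (x i)
      else uniform_measure lborel (allowable_region V \<sigma> x i))"

definition gathered :: "real \<Rightarrow> ('a \<Rightarrow> point) \<Rightarrow> bool" where
  "gathered V x \<longleftrightarrow> (\<exists>c. \<forall>i. x i \<in> cball c (V / 2))"

text \<open>The \<open>\<sigma>\<close>-algebra generated by a past \<open>G\<close> and the current set of active agents.\<close>

definition past_and_active :: "'w measure \<Rightarrow> ('w \<Rightarrow> 'a set) \<Rightarrow> 'w measure" where
  "past_and_active G S =
     sigma (space G) (sets G \<union> {{\<omega> \<in> space G. S \<omega> = T} | T. True})"

text \<open>\<open>p k \<omega> i\<close> is the position of agent \<open>i\<close> at time-step \<open>k\<close> and \<open>A k \<omega>\<close>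
  is the set of agents active at time-step \<open>k\<close>. The past \<open>F k\<close> contains all the positions
  up to time \<open>k\<close> and all the active sets before time \<open>k\<close>.
  The law of each single active agent's move is prescribed, conditionally on the past and on the
  set of active agents; the joint law of simultaneous moves is left unconstrained, which
  in particular covers independent moves.\<close>

locale gathering_process = prob_space M
  for M :: "'w measure" +
  fixes F :: "nat \<Rightarrow> 'w measure"
    and V \<sigma> :: real
    and p :: "nat \<Rightarrow> 'w \<Rightarrow> 'a::finite \<Rightarrow> point"
    and A :: "nat \<Rightarrow> 'w \<Rightarrow> 'a set"
  assumes V_pos: "V > 0"
    and \<sigma>_pos: "\<sigma> > 0"
    and filtration_past: "filtration (space M) F"
    and subalgebra_past: "\<And>k. subalgebra M (F k)"
    and position_adapted: "\<And>k i. (\<lambda>\<omega>. p k \<omega> i) \<in> borel_measurable (F k)"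
    and active_adapted: "\<And>k. A k \<in> measurable (F (Suc k)) (count_space UNIV)"
    and strong_asynchronicity:
      "\<exists>\<delta>>0. \<forall>S k. AE \<omega> in M.
         real_cond_exp M (F k) (indicat_real {\<omega>' \<in> space M. A k \<omega>' = S}) \<omega> \<ge> \<delta>"
    and inactive_stay:
      "\<And>k i. AE \<omega> in M. i \<notin> A k \<omega> \<longrightarrow> p (Suc k) \<omega> i = p k \<omega> i"
    and active_move:
      "\<And>k i B. B \<in> sets borel \<Longrightarrow> AE \<omega> in M. i \<in> A k \<omega> \<longrightarrow>
         real_cond_exp M (past_and_active (F k) (A k))
           (indicat_real {\<omega>' \<in> space M. p (Suc k) \<omega>' i \<in> B}) \<omega>
         = measure (step_distribution V \<sigma> (p k \<omega>) i) B"

text \<open>The first time of gathering, equal to \<open>\<infinity>\<close> (the infimum of the empty set) on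
  outcomes for which the agents never gather.\<close>

definition gathering_time :: "real \<Rightarrow> (nat \<Rightarrow> 'w \<Rightarrow> 'a \<Rightarrow> point) \<Rightarrow> 'w \<Rightarrow> ennreal" where
  "gathering_time V p \<omega> = (INF k\<in>{k. gathered V (p k \<omega>)}. of_nat k)"

end

theory Submission
  imports Defs
begin

text \<open>The potential is the sum of the squared distances of all pairs of agents. It is bounded on
  connected constellations, and connectivity almost surely persists. Some agent \<open>i\<close>
  sees all others within an angle bounded away from \<open>\<pi>\<close> in terms of \<open>n\<close> only; a move of fixed length \<open>t\<close> along the
  axis of that angle is allowed, with room to spare, and changes the potential by at most
  a constant times \<open>t\<^sup>2\<close> minus a constant times \<open>t\<close> times the sum of the distances to agent \<open>i\<close>. As long as
  no agent has all others within distance \<open>V / 2\<close>, that sum exceeds \<open>V / 2\<close>, so that a suitable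
  \<open>t\<close> makes the potential drop by a fixed amount. Such a drop has conditional probability bounded
  below: the corner agent is the only active one with probability at least \<open>\<delta>\<close>, and the good
  positions contain a ball of fixed radius. Boundedly many consecutive drops are impossible without
  gathering, so the gathering time has geometric tails.\<close>

section \<open>Moves of a corner agent\<close>


text \<open>Subtracting the two inner products leaves \<open>(m' - m) * d$2\<close> with an integer
  factor of at least 1, which bounds \<open>d$2\<close>; substituting this into the first one bounds
  \<open>d$1\<close>. With \<open>\<eta>\<close> a small multiple of \<open>norm d\<close> this is
  contradictory.\<close>

lemma shallow_directions_unique:
  fixes d :: "real^2" and m m' :: nat
  assumes "m < m'" "m' \<le> N"
    and a: "\<bar>vector [1, real m] \<bullet> d\<bar> < \<eta>" "\<bar>vector [1, real m'] \<bullet> d\<bar> < \<eta>"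
  shows "norm d < 3 * (1 + real N) * \<eta>"
proof -
  have e: "vector [1, real k] \<bullet> d = d$1 + real k * d$2" for k
    by (simp add: inner_vec_def sum_2)
  have "\<bar>d$2\<bar> \<le> (real m' - real m) * \<bar>d$2\<bar>"
    using assms(1) mult_right_mono[of 1 "real m' - real m" "\<bar>d$2\<bar>"] by simp
  also have "\<dots> = \<bar>(real m' - real m) * d$2\<bar>"
    using assms(1) by (simp add: abs_mult)
  also have "\<dots> < 2 * \<eta>" using a unfolding e by (simp add: algebra_simps)
  finally have d2: "\<bar>d$2\<bar> < 2 * \<eta>" .
  then have eta: "\<eta> > 0" by simp
  have "real m * \<bar>d$2\<bar> \<le> (real N - 1) * (2 * \<eta>)"
    using assms d2 by (intro mult_mono) auto
  moreover have "\<bar>d$1\<bar> \<le> \<eta> + real m * \<bar>d$2\<bar>"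
  proof -
    have "\<bar>real m * d$2\<bar> = real m * \<bar>d$2\<bar>" by (simp add: abs_mult)
    then show ?thesis using a(1) unfolding e by linarith
  qed
  moreover have "norm d \<le> \<bar>d$1\<bar> + \<bar>d$2\<bar>"
    using norm_le_l1_cart[of d] by (simp add: sum_2)
  ultimately have "norm d < \<eta> + (real N - 1) * (2 * \<eta>) + 2 * \<eta>"
    using d2 by simp
  also have "\<dots> \<le> 3 * (1 + real N) * \<eta>" using eta by (simp add: algebra_simps)
  finally show ?thesis .
qed

text \<open>Of sufficiently many fixed directions, each pair of agents can be nearly orthogonal to at
  most one, so some direction is transversal to all pairs; the corner is the agent minimal in it.\<close>

lemma transversal_directions:
  obtains \<kappa> :: real and D :: "point set"
  where "\<kappa> > 0" "\<kappa> \<le> 1" "finite D" "\<And>b. b \<in> D \<Longrightarrow> norm b = 1"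
    "\<And>x :: 'a::finite \<Rightarrow> point. \<exists>b\<in>D. \<exists>i. \<forall>j. \<kappa> * norm (x j - x i) \<le> b \<bullet> (x j - x i)"
proof -
  define N where "N = card (UNIV :: ('a \<times> 'a) set)"
  define f :: "nat \<Rightarrow> point" where "f = (\<lambda>m. vector [1, real m])"
  \<comment> \<open>Chosen so that \<open>shallow_directions_unique\<close> with
    \<open>\<eta> = \<kappa> * norm d * (1 + real N)\<close> yields
    \<open>norm d < norm d\<close>.\<close>
  define \<kappa> where "\<kappa> = 1 / (3 * (1 + real N)\<^sup>2)"
  have fpos: "norm (f m) > 0" for m
  proof -
    have "f m $ 1 = 1" by (simp add: f_def)
    then have "f m \<noteq> 0" by (metis zero_index zero_neq_one)
    then show ?thesis by simp
  qed
  have fle: "norm (f m) \<le> 1 + real N" if "m \<le> N" for m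
    using norm_le_l1_cart[of "f m"] that by (simp add: sum_2 f_def)
  have transversal: "\<exists>m\<le>N. \<forall>i j. \<kappa> * norm (x j - x i) \<le> \<bar>(f m /\<^sub>R norm (f m)) \<bullet> (x j - x i)\<bar>"
    for x :: "'a \<Rightarrow> point"
  proof (rule ccontr)
    assume "\<not> ?thesis"
    then have "\<forall>m\<in>{..N}. \<exists>q. \<bar>(f m /\<^sub>R norm (f m)) \<bullet> (x (snd q) - x (fst q))\<bar>
                 < \<kappa> * norm (x (snd q) - x (fst q))"
      by (auto simp: not_le split_paired_Ex simp del: inner_scaleR_left) (metis not_le)
    then obtain h where h: "\<And>m. m \<le> N \<Longrightarrow> \<bar>(f m /\<^sub>R norm (f m)) \<bullet> (x (snd (h m)) - x (fst (h m)))\<bar>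
                 < \<kappa> * norm (x (snd (h m)) - x (fst (h m)))"
      unfolding bchoice_iff by (metis atMost_iff)
    \<comment> \<open>Pigeonhole: there are \<open>N + 1\<close> directions but only
      \<open>N\<close> ordered pairs of agents to spoil them.\<close>
    have "\<not> inj_on h {..N}"
    proof
      assume "inj_on h {..N}"
      then have "card {..N} \<le> card (UNIV :: ('a \<times> 'a) set)"
        by (rule card_inj_on_le) auto
      then show False by (simp add: N_def)
    qed
    then obtain m m' where m: "m < m'" "m' \<le> N" "h m = h m'"
      unfolding inj_on_def by (metis atMost_iff linorder_neqE_nat)
    define d where "d = x (snd (h m)) - x (fst (h m))"
    have small: "\<bar>f k \<bullet> d\<bar> < \<kappa> * norm d * (1 + real N)" if "k \<le> N" "h k = h m" for k
    proof -
      have "\<bar>(f k /\<^sub>R norm (f k)) \<bullet> d\<bar> < \<kappa> * norm d" using h[OF that(1)] that(2) by (simp add: d_def)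
      then have "\<bar>f k \<bullet> d\<bar> < \<kappa> * norm d * norm (f k)"
        using fpos[of k] by (simp add: abs_mult field_simps)
      moreover have "\<dots> \<le> \<kappa> * norm d * (1 + real N)"
        using fle[OF that(1)] by (intro mult_left_mono) (auto simp: \<kappa>_def)
      ultimately show ?thesis by simp
    qed
    have "norm d < 3 * (1 + real N) * (\<kappa> * norm d * (1 + real N))"
      using shallow_directions_unique[OF m(1,2)] small[of m] small[of m'] m by (simp add: f_def)
    also have "\<dots> = norm d * (\<kappa> * (3 * (1 + real N)\<^sup>2))" by (simp add: power2_eq_square)
    also have "\<dots> = norm d" by (simp add: \<kappa>_def)
    finally show False by simp
  qed
  show ?thesis
  proof (rule that[of \<kappa> "(\<lambda>m. f m /\<^sub>R norm (f m)) ` {..N}"])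
    show "\<kappa> > 0" by (simp add: \<kappa>_def)
    have "1 \<le> (1 + real N)\<^sup>2" by (simp add: one_le_power)
    then have "1 \<le> 3 * (1 + real N)\<^sup>2" by linarith
    then show "\<kappa> \<le> 1" by (simp add: \<kappa>_def)
    show "norm b = 1" if "b \<in> (\<lambda>m. f m /\<^sub>R norm (f m)) ` {..N}" for b
      using that fpos by auto
    show "\<exists>b\<in>(\<lambda>m. f m /\<^sub>R norm (f m)) ` {..N}. \<exists>i. \<forall>j. \<kappa> * norm (x j - x i) \<le> b \<bullet> (x j - x i)"
      for x :: "'a \<Rightarrow> point"
    proof -
      obtain m where m: "m \<le> N"
        "\<And>i j. \<kappa> * norm (x j - x i) \<le> \<bar>(f m /\<^sub>R norm (f m)) \<bullet> (x j - x i)\<bar>"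
        using transversal by blast
      let ?b = "f m /\<^sub>R norm (f m)"
      obtain i where "is_arg_min (\<lambda>i. ?b \<bullet> x i) (\<lambda>i. i \<in> UNIV) i"
        using ex_is_arg_min_if_finite[of UNIV "\<lambda>i. ?b \<bullet> x i"] by auto
      then have "?b \<bullet> x i \<le> ?b \<bullet> x j" for j by (auto simp: is_arg_min_linorder)
      then have "\<kappa> * norm (x j - x i) \<le> ?b \<bullet> (x j - x i)" for j
        using m(2)[of j i] by (simp add: inner_diff_right)
      with m(1) show ?thesis by blast
    qed
  qed simp
qed

section \<open>The potential and its change under a single move\<close>

definition potential :: "('a::finite \<Rightarrow> point) \<Rightarrow> real" where
  "potential x = (\<Sum>i\<in>UNIV. \<Sum>j\<in>UNIV. (norm (x i - x j))\<^sup>2)"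

text \<open>Gathering with an agent as the centre of the disc. Its negation gives every agent
  another one farther than \<open>V / 2\<close> away, and as a finite combination of distance
  comparisons it is measurable without a search for a centre.\<close>

definition centred :: "real \<Rightarrow> ('a \<Rightarrow> point) \<Rightarrow> bool" where
  "centred V x \<longleftrightarrow> (\<exists>i. \<forall>j. norm (x j - x i) \<le> V / 2)"

lemma centred_imp_gathered: "centred V x \<Longrightarrow> gathered V x"
  by (auto simp: centred_def gathered_def dist_norm norm_minus_commute)

lemma potential_nonneg: "potential x \<ge> 0"
  by (auto simp: potential_def intro!: sum_nonneg)

text \<open>Only the second sum is affected by a move of \<open>i\<close>; its factor 2 comes from
  counting ordered pairs.\<close>

lemma potential_split:
  fixes x :: "'a::finite \<Rightarrow> point"
  shows "potential x = (\<Sum>a\<in>-{i}. \<Sum>b\<in>-{i}. (norm (x a - x b))\<^sup>2) + 2 * (\<Sum>j\<in>-{i}. (norm (x j - x i))\<^sup>2)"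
proof -
  have split: "(\<Sum>a\<in>UNIV. g a) = g i + (\<Sum>a\<in>-{i}. g a)" for g :: "'a \<Rightarrow> real"
    by (simp add: sum.remove[of UNIV i] Compl_eq_Diff_UNIV)
  have "(\<Sum>j\<in>-{i}. (norm (x i - x j))\<^sup>2) = (\<Sum>j\<in>-{i}. (norm (x j - x i))\<^sup>2)"
    by (simp add: norm_minus_commute)
  then show ?thesis
    unfolding potential_def split sum.distrib by simp
qed

lemma potential_move:
  fixes x :: "'a::finite \<Rightarrow> point"
  shows "potential (x(i := x i + v)) = potential x + 2 * (\<Sum>j\<in>-{i}. (norm v)\<^sup>2 - 2 * (v \<bullet> (x j - x i)))"
proof -
  have "(norm (x j - (x i + v)))\<^sup>2 = (norm (x j - x i))\<^sup>2 + ((norm v)\<^sup>2 - 2 * (v \<bullet> (x j - x i)))" for j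
    unfolding power2_norm_eq_inner by (simp add: inner_diff inner_add inner_commute algebra_simps)
  then have "(\<Sum>j\<in>-{i}. (norm (x j - (x i + v)))\<^sup>2)
      = (\<Sum>j\<in>-{i}. (norm (x j - x i))\<^sup>2) + (\<Sum>j\<in>-{i}. (norm v)\<^sup>2 - 2 * (v \<bullet> (x j - x i)))"
    unfolding sum.distrib[symmetric] by (intro sum.cong) auto
  then show ?thesis
    unfolding potential_split[of _ i] by simp
qed

lemma potential_le:
  fixes x :: "'a::finite \<Rightarrow> point"
  assumes "\<And>i j. norm (x i - x j) \<le> L"
  shows "potential x \<le> (real CARD('a))\<^sup>2 * L\<^sup>2"
proof -
  have "potential x \<le> (\<Sum>i\<in>(UNIV::'a set). \<Sum>j\<in>(UNIV::'a set). L\<^sup>2)"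
    unfolding potential_def by (intro sum_mono power_mono assms) auto
  then show ?thesis by (simp add: power2_eq_square)
qed

text \<open>Since \<open>a\<close> is on the boundary circle, the squares of \<open>V / 2\<close>
  cancel when the distance is squared. What remains compares a term quadratic in \<open>v\<close>
  with a linear one, so a short step is allowed once it points sufficiently towards
  \<open>b\<close>.\<close>

lemma disc_centre_cball_iff:
  assumes "b \<noteq> a" "V \<ge> 0"
  shows "a + v \<in> cball (disc_centre V a b) (V / 2)
    \<longleftrightarrow> (norm v)\<^sup>2 * norm (b - a) \<le> V * (v \<bullet> (b - a))"
proof -
  define d r where "d = b - a" and "r = norm d"
  have r: "r > 0" "r\<^sup>2 = d \<bullet> d" using assms by (auto simp: d_def r_def power2_norm_eq_inner)
  have "dist (disc_centre V a b) (a + v) = norm ((V / 2) *\<^sub>R (d /\<^sub>R r) - v)"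
    by (simp add: disc_centre_def dist_norm d_def r_def)
  then have "a + v \<in> cball (disc_centre V a b) (V / 2)
    \<longleftrightarrow> (norm ((V / 2) *\<^sub>R (d /\<^sub>R r) - v))\<^sup>2 \<le> (V / 2)\<^sup>2"
    using assms(2) by (simp add: abs_le_square_iff[symmetric])
  also have "(norm ((V / 2) *\<^sub>R (d /\<^sub>R r) - v))\<^sup>2
      = (V / 2)\<^sup>2 * ((d \<bullet> d) / r\<^sup>2) - V * (v \<bullet> d) / r + (norm v)\<^sup>2"
    unfolding power2_norm_eq_inner using r(1)
    by (simp add: inner_diff_left inner_diff_right inner_commute power2_eq_square field_simps)
  also have "(d \<bullet> d) / r\<^sup>2 = 1" unfolding r(2)[symmetric] using r(1) by simp
  also have "((V / 2)\<^sup>2 * 1 - V * (v \<bullet> d) / r + (norm v)\<^sup>2 \<le> (V / 2)\<^sup>2)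
      \<longleftrightarrow> (norm v)\<^sup>2 * r \<le> V * (v \<bullet> d)"
    using r(1) by (simp add: field_simps)
  finally show ?thesis by (simp add: r_def d_def)
qed

lemma corner_inner_ge:
  fixes b v d :: point
  assumes "norm (v - t *\<^sub>R b) \<le> \<rho>" "\<kappa> * norm d \<le> b \<bullet> d" "t \<ge> 0"
  shows "(t * \<kappa> - \<rho>) * norm d \<le> v \<bullet> d"
proof -
  have "\<bar>(v - t *\<^sub>R b) \<bullet> d\<bar> \<le> \<rho> * norm d"
    using Cauchy_Schwarz_ineq2[of "v - t *\<^sub>R b" d] mult_right_mono[OF assms(1), of "norm d"] by simp
  moreover have "t * (\<kappa> * norm d) \<le> t * (b \<bullet> d)" using assms by (intro mult_left_mono) auto
  ultimately show ?thesis by (simp add: inner_diff_left algebra_simps)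
qed

lemma corner_move_length:
  fixes b v :: point
  assumes "norm (v - t *\<^sub>R b) \<le> t * \<kappa> / 4" "norm b = 1" "t > 0" "\<kappa> \<le> 1"
  shows "norm v \<le> 2 * t" "(norm v)\<^sup>2 \<le> 2 * t\<^sup>2"
proof -
  have "norm v \<le> norm (t *\<^sub>R b) + norm (v - t *\<^sub>R b)"
    using norm_triangle_ineq[of "t *\<^sub>R b" "v - t *\<^sub>R b"] by simp
  also have "\<dots> \<le> t + t * 1 / 4"
  proof -
    have "t * \<kappa> \<le> t" using assms by simp
    moreover have "norm (t *\<^sub>R b) = t" using assms by simp
    ultimately show ?thesis using assms(1) by linarith
  qed
  finally have v: "norm v \<le> 5/4 * t" by simp
  then show "norm v \<le> 2 * t" using assms by simp
  have "(norm v)\<^sup>2 \<le> (5/4 * t)\<^sup>2" using v by (intro power_mono) auto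
  also have "\<dots> \<le> 2 * t\<^sup>2" by (simp add: power2_eq_square)
  finally show "(norm v)\<^sup>2 \<le> 2 * t\<^sup>2" .
qed

text \<open>The squared length of the step is at most \<open>2 * t\<^sup>2\<close>, hence at most
  \<open>t * \<kappa> * V / 2\<close> by the choice of \<open>t\<close>, while the linear side of
  the disc condition provides \<open>3/4 * t * \<kappa> * V\<close>, both times the distance. The
  slack in \<open>v\<close> makes a whole ball of targets available, which is what gives positive
  probability.\<close>

lemma corner_move_allowed:
  fixes x :: "'a \<Rightarrow> point"
  assumes "V > 0" "\<kappa> > 0" "\<kappa> \<le> 1" "norm b = 1" "0 < t" "t \<le> \<kappa> * V / 4" "t \<le> \<sigma> / 2"
    and corner: "\<And>j. \<kappa> * norm (x j - x i) \<le> b \<bullet> (x j - x i)"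
    and v: "norm (v - t *\<^sub>R b) \<le> t * \<kappa> / 4"
  shows "x i + v \<in> allowable_region V \<sigma> x i"
proof -
  have "\<kappa> * V \<le> V" using assms by simp
  then have "norm v \<le> min (V / 2) \<sigma>"
    using corner_move_length(1)[OF v] assms by linarith
  moreover have "(norm v)\<^sup>2 * norm (x j - x i) \<le> V * (v \<bullet> (x j - x i))" for j
  proof -
    have "V * ((t * \<kappa> - t * \<kappa> / 4) * norm (x j - x i)) \<le> V * (v \<bullet> (x j - x i))"
      using corner_inner_ge[OF v corner[of j]] assms by (intro mult_left_mono) auto
    moreover have "(norm v)\<^sup>2 \<le> V * (t * \<kappa> - t * \<kappa> / 4)"
    proof -
      have "t * t \<le> t * (\<kappa> * V / 4)" using assms by (intro mult_left_mono) auto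
      moreover have "t * (\<kappa> * V) > 0" using assms by simp
      moreover have "(norm v)\<^sup>2 \<le> 2 * (t * t)"
        using corner_move_length(2)[OF v] assms by (simp add: power2_eq_square)
      moreover have "V * (t * \<kappa> - t * \<kappa> / 4) = 3 * (t * (\<kappa> * V / 4))" by (simp add: algebra_simps)
      ultimately show ?thesis by (simp add: algebra_simps)
    qed
    then have "(norm v)\<^sup>2 * norm (x j - x i) \<le> V * (t * \<kappa> - t * \<kappa> / 4) * norm (x j - x i)"
      by (rule mult_right_mono) simp
    ultimately show ?thesis by (simp add: mult.assoc)
  qed
  ultimately show ?thesis
    using disc_centre_cball_iff[of _ "x i" V v] assms(1)
    by (auto simp: allowable_region_def dist_norm)
qed

text \<open>In \<open>potential_move\<close> a single agent farther than \<open>V / 2\<close> makes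
  the linear terms contribute a decrease of at least \<open>3/2 * t * \<kappa> * V\<close>, as the
  inner products of the others are nonnegative; the quadratic terms cost at most
  \<open>t * \<kappa> * V\<close>, because the bound on \<open>t\<close> has \<open>CARD('a)\<close>
  in its denominator.\<close>

lemma corner_move_potential:
  fixes x :: "'a::finite \<Rightarrow> point"
  assumes "V > 0" "\<kappa> > 0" "\<kappa> \<le> 1" "norm b = 1" "0 < t" "t \<le> \<kappa> * V / (4 * real CARD('a))"
    and corner: "\<And>j. \<kappa> * norm (x j - x i) \<le> b \<bullet> (x j - x i)"
    and v: "norm (v - t *\<^sub>R b) \<le> t * \<kappa> / 4"
    and spread: "\<not> centred V x"
  shows "potential (x(i := x i + v)) \<le> potential x - t * \<kappa> * V / 2"
proof -
  obtain j where j: "norm (x j - x i) > V / 2"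
    using spread by (auto simp: centred_def not_le)
  then have ji: "j \<noteq> i" using assms(1) by auto
  have inner: "3/4 * (t * \<kappa>) * norm (x a - x i) \<le> v \<bullet> (x a - x i)" for a
    using corner_inner_ge[OF v corner[of a]] assms by (simp add: algebra_simps)
  have inner_nonneg: "0 \<le> v \<bullet> (x a - x i)" for a
    by (rule order_trans[OF _ inner]) (use assms in auto)
  have "3/4 * (t * \<kappa>) * (V / 2) \<le> 3/4 * (t * \<kappa>) * norm (x j - x i)"
    using j assms by (intro mult_left_mono) auto
  also have "\<dots> \<le> v \<bullet> (x j - x i)" by (rule inner)
  also have "\<dots> \<le> (\<Sum>a\<in>-{i}. v \<bullet> (x a - x i))"
    using ji inner_nonneg by (intro member_le_sum) auto
  finally have A: "3/4 * (t * \<kappa>) * (V / 2) \<le> (\<Sum>a\<in>-{i}. v \<bullet> (x a - x i))" .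
  have "(\<Sum>a\<in>-{i}. (norm v)\<^sup>2) \<le> real CARD('a) * (norm v)\<^sup>2"
    by (simp add: Compl_eq_Diff_UNIV card_Diff_singleton mult_right_mono)
  also have "\<dots> \<le> real CARD('a) * (2 * t\<^sup>2)"
    using corner_move_length(2)[OF v] assms by (intro mult_left_mono) auto
  also have "\<dots> = 2 * t * (real CARD('a) * t)" by (simp add: power2_eq_square)
  also have "\<dots> \<le> 2 * t * (\<kappa> * V / 4)"
    using assms by (intro mult_left_mono) (auto simp: field_simps)
  finally have B: "(\<Sum>a\<in>-{i}. (norm v)\<^sup>2) \<le> t * \<kappa> * V / 2" by (simp add: algebra_simps)
  have "t * \<kappa> * V > 0" using assms by simp
  then show ?thesis
    unfolding potential_move sum_subtractf sum_distrib_left[symmetric] using A B by (simp add: algebra_simps)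
qed

section \<open>Connected constellations: bounded potential and preserved edges\<close>

lemma norm_relpow_neighbourhood_graph:
  assumes "(i, j) \<in> neighbourhood_graph V x ^^ n"
  shows "norm (x i - x j) \<le> real n * V"
  using assms
proof (induction n arbitrary: j)
  case (Suc n)
  then obtain k where k: "norm (x i - x k) \<le> real n * V" "norm (x k - x j) < V"
    by (auto simp: neighbourhood_graph_def neighbours_def)
  have "norm (x i - x j) \<le> norm (x i - x k) + norm (x k - x j)"
    using norm_triangle_ineq[of "x i - x k" "x k - x j"] by simp
  with k show ?case by (simp add: algebra_simps)
qed auto

text \<open>Two agents are joined by a path with no more steps than the relation has pairs, and each
  step is shorter than \<open>V\<close>.\<close>

lemma connected_potential_le:
  fixes x :: "'a::finite \<Rightarrow> point"
  assumes "connected_constellation V x" "V > 0"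
  shows "potential x \<le> (real CARD('a))\<^sup>2 * (real CARD('a \<times> 'a) * V)\<^sup>2"
proof (rule potential_le)
  fix i j
  let ?R = "neighbourhood_graph V x"
  have "(i, j) \<in> ?R\<^sup>*" using assms by (simp add: connected_constellation_def)
  then obtain n where n: "n \<le> card ?R" "(i, j) \<in> ?R ^^ n"
    by (auto simp: rtrancl_finite_eq_relpow[OF finite])
  have "n \<le> CARD('a \<times> 'a)" using n(1) card_mono[of UNIV ?R] by simp
  then have "real n * V \<le> real CARD('a \<times> 'a) * V" using assms by (intro mult_right_mono) linarith+
  then show "norm (x i - x j) \<le> real CARD('a \<times> 'a) * V"
    using norm_relpow_neighbourhood_graph[OF n(2)] by linarith
qed

text \<open>The midpoint of two neighbours lies strictly between the two centres of discs containing the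
  new position, so by strict convexity the new position is in the open disc around it.\<close>

lemma allowable_near_midpoint:
  assumes "V > 0" "j \<in> neighbours V x i" "x j \<noteq> x i" "y \<in> allowable_region V \<sigma> x i"
  shows "norm (y - midpoint (x i) (x j)) < V / 2"
proof -
  define v where "v = y - x i"
  define d where "d = x j - x i"
  have d: "norm d < V" "norm d > 0"
    using assms by (auto simp: neighbours_def d_def norm_minus_commute)
  have "y \<in> cball (disc_centre V (x i) (x j)) (V / 2)" and v: "norm v \<le> V / 2"
    using assms by (auto simp: allowable_region_def v_def dist_norm norm_minus_commute)
  then have disc: "(norm v)\<^sup>2 * norm d \<le> V * (v \<bullet> d)"
    using disc_centre_cball_iff[of "x j" "x i" V v] assms by (simp add: v_def d_def)
  \<comment> \<open>Scaling by \<open>V\<close> lets the disc condition replace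
    \<open>V * (v \<bullet> d)\<close> by \<open>norm d * (norm v)\<^sup>2\<close>. The result is
    increasing in \<open>norm v\<close>, so \<open>norm v \<le> V / 2\<close> can be inserted;
    strictness then comes from \<open>0 < norm d < V\<close>.\<close>
  have "V * (norm (v - d /\<^sub>R 2))\<^sup>2 = V * (norm v)\<^sup>2 - V * (v \<bullet> d) + V * (norm d)\<^sup>2 / 4"
    unfolding power2_norm_eq_inner by (simp add: inner_diff inner_commute algebra_simps)
  also have "\<dots> \<le> (V - norm d) * (norm v)\<^sup>2 + V * (norm d)\<^sup>2 / 4"
    using disc by (simp add: algebra_simps)
  also have "\<dots> \<le> (V - norm d) * (V / 2)\<^sup>2 + V * (norm d)\<^sup>2 / 4"
    using v d by (intro add_right_mono mult_left_mono power_mono) auto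
  also have "\<dots> < V * (V / 2)\<^sup>2"
  proof -
    have "V * norm d * norm d < V * norm d * V" using d assms by (intro mult_strict_left_mono) auto
    then have "0 < (V * norm d * V - V * norm d * norm d) / 4" by simp
    also have "\<dots> = V * (V / 2)\<^sup>2 - ((V - norm d) * (V / 2)\<^sup>2 + V * (norm d)\<^sup>2 / 4)"
      by (simp add: power2_eq_square field_simps)
    finally show ?thesis by (simp only: diff_gt_0_iff_gt)
  qed
  finally have "(norm (v - d /\<^sub>R 2))\<^sup>2 < (V / 2)\<^sup>2"
    by (simp only: mult_less_cancel_left_pos[OF assms(1)])
  then have "norm (v - d /\<^sub>R 2) < V / 2"
    by (rule power_less_imp_less_base) (use assms(1) in simp)
  moreover have "y - midpoint (x i) (x j) = v - d /\<^sub>R 2"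
    unfolding v_def d_def midpoint_def vec_eq_iff by (simp add: field_simps)
  ultimately show ?thesis by simp
qed

text \<open>No edge is lost, since both new positions lie in the open disc of radius
  \<open>V / 2\<close> about the old midpoint. For collocated neighbours this midpoint is their
  common position, and the strict bound comes from excluding steps of length
  \<open>V / 2\<close>.\<close>

lemma connected_step:
  assumes "V > 0" "connected_constellation V x"
    and y: "\<And>i. y i \<in> allowable_region V \<sigma> x i" "\<And>i. norm (y i - x i) \<noteq> V / 2"
  shows "connected_constellation V y"
proof -
  have "j \<in> neighbours V y i" if "j \<in> neighbours V x i" for i j
  proof -
    have i: "i \<in> neighbours V x j" using that by (auto simp: neighbours_def norm_minus_commute)
    define m where "m = midpoint (x i) (x j)"
    have half: "norm (y i - m) < V / 2 \<and> norm (y j - m) < V / 2"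
    proof (cases "x j = x i")
      case True
      have "norm (y k - x k) < V / 2" for k
        using y(1)[of k] y(2)[of k] by (auto simp: allowable_region_def dist_norm norm_minus_commute)
      then show ?thesis using True by (metis m_def midpoint_idem)
    next
      case False
      then show ?thesis
        using allowable_near_midpoint[OF assms(1) that _ y(1)] allowable_near_midpoint[OF assms(1) i _ y(1)]
        by (auto simp: m_def midpoint_sym)
    qed
    have "norm (y i - y j) \<le> norm (y i - m) + norm (y j - m)"
      using norm_triangle_ineq4[of "y i - m" "y j - m"] by simp
    with half that show ?thesis by (auto simp: neighbours_def)
  qed
  then have "neighbourhood_graph V x \<subseteq> neighbourhood_graph V y"
    by (auto simp: neighbourhood_graph_def)
  then show ?thesis
    using assms(2) rtrancl_mono unfolding connected_constellation_def by blast
qed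

section \<open>Conditional probabilities on a countable cover\<close>

lemma (in prob_space)
  assumes "subalgebra M G" "D \<in> sets G" "B \<in> events"
  shows integrable_indicator_cond_exp:
      "integrable M (\<lambda>\<omega>. indicat_real D \<omega> * real_cond_exp M G (indicat_real B) \<omega>)"
    and prob_Int_eq_integral_cond_exp:
      "prob (D \<inter> B) = (\<integral>\<omega>. indicat_real D \<omega> * real_cond_exp M G (indicat_real B) \<omega> \<partial>M)"
proof -
  interpret finite_measure_subalgebra M G by unfold_locales fact
  have [measurable]: "D \<in> events" using assms by (auto simp: subalgebra_def)
  note [measurable] = assms(3)
  have eq: "(\<lambda>\<omega>. indicat_real D \<omega> * indicat_real B \<omega>) = indicat_real (D \<inter> B)"
    by (auto simp: indicator_def)
  have int: "integrable M (\<lambda>\<omega>. indicat_real D \<omega> * indicat_real B \<omega>)"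
    unfolding eq by (simp add: emeasure_eq_measure)
  have meas: "indicat_real D \<in> borel_measurable G" using assms(2) by simp
  show "integrable M (\<lambda>\<omega>. indicat_real D \<omega> * real_cond_exp M G (indicat_real B) \<omega>)"
    by (rule real_cond_exp_intg(1)[OF int meas]) simp
  show "prob (D \<inter> B) = (\<integral>\<omega>. indicat_real D \<omega> * real_cond_exp M G (indicat_real B) \<omega> \<partial>M)"
    using real_cond_exp_intg(2)[OF int meas] unfolding eq by simp
qed

lemma (in prob_space)
  assumes "subalgebra M G" "D \<in> sets G" "B \<in> events"
  shows prob_Int_ge_cond_exp:
      "(AE \<omega> in M. \<omega> \<in> D \<longrightarrow> c \<le> real_cond_exp M G (indicat_real B) \<omega>) \<Longrightarrow> c * prob D \<le> prob (D \<inter> B)"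
    and prob_Int_le_cond_exp:
      "(AE \<omega> in M. \<omega> \<in> D \<longrightarrow> real_cond_exp M G (indicat_real B) \<omega> \<le> c) \<Longrightarrow> prob (D \<inter> B) \<le> c * prob D"
proof -
  have [measurable]: "D \<in> events" using assms by (auto simp: subalgebra_def)
  have int: "integrable M (\<lambda>\<omega>. indicat_real D \<omega> * c)"
    by (simp add: emeasure_eq_measure)
  have val: "(\<integral>\<omega>. indicat_real D \<omega> * c \<partial>M) = c * prob D" by simp
  show "c * prob D \<le> prob (D \<inter> B)"
    if "AE \<omega> in M. \<omega> \<in> D \<longrightarrow> c \<le> real_cond_exp M G (indicat_real B) \<omega>"
    unfolding val[symmetric] prob_Int_eq_integral_cond_exp[OF assms]
    by (rule integral_mono_AE[OF int integrable_indicator_cond_exp[OF assms]])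
       (use that in \<open>eventually_elim, auto simp: indicator_def\<close>)
  show "prob (D \<inter> B) \<le> c * prob D"
    if "AE \<omega> in M. \<omega> \<in> D \<longrightarrow> real_cond_exp M G (indicat_real B) \<omega> \<le> c"
    unfolding val[symmetric] prob_Int_eq_integral_cond_exp[OF assms]
    by (rule integral_mono_AE[OF integrable_indicator_cond_exp[OF assms] int])
       (use that in \<open>eventually_elim, auto simp: indicator_def\<close>)
qed

text \<open>Conditional laws are prescribed for fixed target sets, whereas the useful targets depend
  on the random positions. On each piece \<open>C n\<close> one fixed target serves; the pieces are
  made disjoint inside \<open>E\<close> and the inequalities are summed. Hence \<open>le\<close> is
  required for all events \<open>D\<close> of \<open>G\<close> inside a piece.\<close>

lemma (in prob_space) prob_Int_mono_countable_cover:
  fixes a b :: real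
  assumes "subalgebra M G" and E: "E \<in> sets G" and I: "countable I"
    and C: "\<And>n. n \<in> I \<Longrightarrow> C n \<in> sets G" and cover: "E \<subseteq> (\<Union>n\<in>I. C n)"
    and H: "H \<in> events" "H' \<in> events"
    and le: "\<And>n D. n \<in> I \<Longrightarrow> D \<in> sets G \<Longrightarrow> D \<subseteq> C n \<Longrightarrow> a * prob (D \<inter> H) \<le> b * prob (D \<inter> H')"
  shows "a * prob (E \<inter> H) \<le> b * prob (E \<inter> H')"
proof (cases "I = {}")
  case True
  then show ?thesis using cover by simp
next
  case False
  \<comment> \<open>\<open>from_nat_into\<close> may repeat indices; \<open>disjointed\<close> makes
    the repeated pieces empty.\<close>
  define C' where "C' n = C (from_nat_into I n)" for n
  define D where "D n = E \<inter> disjointed C' n" for n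
  have C': "range C' \<subseteq> sets G" using C from_nat_into[OF False] by (auto simp: C'_def)
  have D: "D n \<in> sets G" for n
    using sets.range_disjointed_sets[OF C'] E by (auto simp: D_def)
  have sub: "sets G \<subseteq> events" using assms(1) by (simp add: subalgebra_def)
  have "disjoint_family D"
    using disjoint_family_disjointed[of C'] by (auto simp: disjoint_family_on_def D_def)
  then have dis: "disjoint_family (\<lambda>n. D n \<inter> K)" for K by (auto simp: disjoint_family_on_def)
  have "(\<Union>n. C' n) = (\<Union>n\<in>I. C n)"
    using range_from_nat_into[OF False I] unfolding C'_def by (metis image_image)
  then have "E \<subseteq> (\<Union>n. disjointed C' n)" using cover by (simp add: UN_disjointed_eq)
  then have un: "(\<Union>n. D n \<inter> K) = E \<inter> K" for K by (auto simp: D_def)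
  have sums: "(\<lambda>n. prob (D n \<inter> K)) sums prob (E \<inter> K)" if "K \<in> events" for K
    using finite_measure_UNION[OF _ dis[of K]] D sub that unfolding un by blast
  show ?thesis
  proof (rule sums_le[OF _ sums_mult[OF sums[OF H(1)]] sums_mult[OF sums[OF H(2)]]])
    fix n
    have "D n \<subseteq> C (from_nat_into I n)"
      using disjointed_subset[of C' n] by (auto simp: D_def C'_def)
    then show "a * prob (D n \<inter> H) \<le> b * prob (D n \<inter> H')"
      by (rule le[OF from_nat_into[OF False] D])
  qed
qed

section \<open>The law of a single step\<close>

lemma closed_allowable_region: "closed (allowable_region V \<sigma> x i)"
  unfolding allowable_region_def by (intro closed_Int closed_INT) auto

lemma sets_allowable_region [measurable]: "allowable_region V \<sigma> x i \<in> sets borel"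
  by (intro borel_closed closed_allowable_region)

lemma self_in_allowable_region:
  assumes "V > 0" "\<sigma> > 0"
  shows "x i \<in> allowable_region V \<sigma> x i"
  using assms disc_centre_cball_iff[of _ "x i" V 0] by (auto simp: allowable_region_def)

lemma allowable_region_subset_cball: "allowable_region V \<sigma> x i \<subseteq> cball (x i) (V / 2)"
  by (auto simp: allowable_region_def)

lemma cball_fmeasurable_lborel: "cball c r \<in> fmeasurable lborel"
  by (rule fmeasurableI[OF _ emeasure_lborel_cball_finite]) simp

lemma allowable_region_fmeasurable: "allowable_region V \<sigma> x i \<in> fmeasurable lborel"
  by (rule fmeasurableI2[OF cball_fmeasurable_lborel allowable_region_subset_cball]) simp

text \<open>If the area vanished, both sides would be \<open>0\<close> by the conventions for division by zero.\<close>

lemma measure_step_distribution: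
  assumes "allowable_region V \<sigma> x i \<noteq> {x i}" "B \<in> sets borel"
  shows "measure (step_distribution V \<sigma> x i) B
    = measure lborel (allowable_region V \<sigma> x i \<inter> B) / measure lborel (allowable_region V \<sigma> x i)"
proof -
  let ?R = "allowable_region V \<sigma> x i"
  have fm: "?R \<inter> B \<in> fmeasurable lborel"
    using assms(2) by (intro fmeasurable_Int_fmeasurable allowable_region_fmeasurable) simp
  have fin: "emeasure lborel ?R = ennreal (measure lborel ?R)"
    "emeasure lborel (?R \<inter> B) = ennreal (measure lborel (?R \<inter> B))"
    by (rule emeasure_eq_measure2, rule allowable_region_fmeasurable, rule emeasure_eq_measure2, rule fm)
  have le: "measure lborel (?R \<inter> B) \<le> measure lborel ?R"
    by (rule measure_mono_fmeasurable[OF _ _ allowable_region_fmeasurable]) (use fm in auto)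
  have "measure (step_distribution V \<sigma> x i) B = enn2real (emeasure lborel (?R \<inter> B) / emeasure lborel ?R)"
    using assms by (simp add: step_distribution_def measure_def)
  also have "\<dots> = measure lborel (?R \<inter> B) / measure lborel ?R"
  proof (cases "measure lborel ?R = 0")
    case True
    then have "measure lborel (?R \<inter> B) = 0" using le measure_nonneg[of lborel "?R \<inter> B"] by linarith
    then show ?thesis unfolding fin True by simp
  next
    case False
    then have "measure lborel ?R > 0" using measure_nonneg[of lborel ?R] by linarith
    then show ?thesis unfolding fin by (simp add: divide_ennreal)
  qed
  finally show ?thesis .
qed

lemma step_distribution_disjoint:
  assumes "V > 0" "\<sigma> > 0" "B \<in> sets borel" "B \<inter> allowable_region V \<sigma> x i = {}"
  shows "measure (step_distribution V \<sigma> x i) B = 0"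
proof (cases "allowable_region V \<sigma> x i = {x i}")
  case True
  then have "x i \<notin> B" using assms by auto
  then show ?thesis using True assms by (simp add: step_distribution_def measure_return)
next
  case False
  then show ?thesis using assms by (simp add: measure_step_distribution Int_commute)
qed

text \<open>Containing a ball, the region is no singleton, so the law is uniform; contained in a
  disc of radius \<open>V / 2\<close>, it has area at most
  \<open>pi * (V / 2)\<^sup>2\<close>.\<close>

lemma step_distribution_ball_ge:
  fixes q :: point
  assumes "V > 0" "r > 0" "ball q r \<subseteq> allowable_region V \<sigma> x i"
  shows "(2 * r / V)\<^sup>2 \<le> measure (step_distribution V \<sigma> x i) (ball q r)"
proof -
  let ?R = "allowable_region V \<sigma> x i"
  have "?R \<noteq> {x i}"
  proof
    assume "?R = {x i}"
    then have "ball q r \<subseteq> {x i}" using assms by simp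
    then have "ball q r = {x i}" using assms(2) by (metis centre_in_ball empty_iff subset_singletonD)
    then show False using not_open_singleton[of "x i"] open_ball[of q r] by simp
  qed
  then have eq: "measure (step_distribution V \<sigma> x i) (ball q r) = measure lborel (ball q r) / measure lborel ?R"
    using assms by (simp add: measure_step_distribution Int_absorb1)
  have "measure lborel ?R \<le> measure lborel (cball (x i) (V / 2))"
    by (intro measure_mono_fmeasurable allowable_region_subset_cball cball_fmeasurable_lborel) simp
  also have "\<dots> = pi * (V / 2)\<^sup>2" using assms by (simp add: content_cball unit_ball_vol_2)
  finally have R: "measure lborel ?R \<le> pi * (V / 2)\<^sup>2" .
  have ball: "measure lborel (ball q r) = pi * r\<^sup>2" using assms by (simp add: content_ball unit_ball_vol_2)
  have "0 < measure lborel (ball q r)" unfolding ball using assms by simp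
  also have "\<dots> \<le> measure lborel ?R" using assms(3) by (intro measure_mono_fmeasurable allowable_region_fmeasurable) auto
  finally have pos: "measure lborel ?R > 0" .
  have "(2 * r / V)\<^sup>2 = pi * r\<^sup>2 / (pi * (V / 2)\<^sup>2)"
    using assms by (simp add: power2_eq_square field_simps)
  also have "\<dots> \<le> pi * r\<^sup>2 / measure lborel ?R"
    using R pos by (intro divide_left_mono) auto
  finally show ?thesis unfolding eq ball .
qed

text \<open>The annulus of half-width \<open>h\<close> has area \<open>2 * pi * V * h\<close>
  wherever its centre lies, so one \<open>m\<close> serves all \<open>q\<close>. This uniformity
  matters because the centre is approximated only after \<open>m\<close> has been fixed.\<close>

lemma step_distribution_thin_annulus:
  assumes "V > 0" "c > 0" "allowable_region V \<sigma> x i \<noteq> {x i}"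
  shows "\<exists>m::nat. \<forall>q. measure (step_distribution V \<sigma> x i)
     (cball q (V / 2 + 1 / Suc m) - ball q (V / 2 - 1 / Suc m)) \<le> c"
proof -
  let ?R = "allowable_region V \<sigma> x i"
  define a where "a = measure lborel ?R"
  have a: "a \<ge> 0" by (simp add: a_def)
  have "\<exists>m::nat. 1 / Suc m < min (V / 2) (c * a / (2 * pi * V))" if "a > 0"
  proof -
    have "min (V / 2) (c * a / (2 * pi * V)) > 0" using that assms(1,2) by simp
    then show ?thesis by (metis nat_approx_posE)
  qed
  then obtain m :: nat where m: "a > 0 \<Longrightarrow> 1 / Suc m < min (V / 2) (c * a / (2 * pi * V))"
    by blast
  have "measure (step_distribution V \<sigma> x i) (cball q (V / 2 + 1 / Suc m) - ball q (V / 2 - 1 / Suc m)) \<le> c" for q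
  proof (cases "a > 0")
    case True
    define h where "h = 1 / real (Suc m)"
    have h: "h > 0" "h < V / 2" "2 * pi * V * h \<le> c * a"
    proof -
      show "h > 0" by (simp add: h_def)
      have *: "h < V / 2 \<and> h < c * a / (2 * pi * V)" using m[OF True] unfolding h_def by simp
      then show "h < V / 2" by simp
      have "2 * pi * V > 0" using assms by simp
      then show "2 * pi * V * h \<le> c * a" using * by (simp add: pos_less_divide_eq mult.commute)
    qed
    have "measure lborel (cball q (V / 2 + h) - ball q (V / 2 - h))
        = measure lborel (cball q (V / 2 + h)) - measure lborel (ball q (V / 2 - h))"
      using h by (intro measurable_measure_Diff cball_fmeasurable_lborel subset_trans[OF ball_subset_cball] subset_cball) auto
    also have "\<dots> = pi * (V / 2 + h)\<^sup>2 - pi * (V / 2 - h)\<^sup>2"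
      using h by (simp add: content_ball content_cball unit_ball_vol_2)
    also have "\<dots> = 2 * pi * V * h" by (simp add: power2_eq_square algebra_simps)
    finally have ann: "measure lborel (cball q (V / 2 + h) - ball q (V / 2 - h)) = 2 * pi * V * h" .
    have "measure lborel (?R \<inter> (cball q (V / 2 + h) - ball q (V / 2 - h)))
        \<le> measure lborel (cball q (V / 2 + h) - ball q (V / 2 - h))"
      by (intro measure_mono_fmeasurable fmeasurable_Diff cball_fmeasurable_lborel) auto
    also have "\<dots> \<le> c * a" using ann h by simp
    finally have "measure (step_distribution V \<sigma> x i) (cball q (V / 2 + h) - ball q (V / 2 - h)) \<le> c"
      using True by (simp add: measure_step_distribution[OF assms(3)] a_def[symmetric] pos_divide_le_eq)
    then show ?thesis unfolding h_def .
  next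
    case False
    \<comment> \<open>Zero area makes the quotient in \<open>measure_step_distribution\<close> zero,
      so any \<open>m\<close> works.\<close>
    then have "a = 0" using a by simp
    then show ?thesis using assms(2) by (simp add: measure_step_distribution[OF assms(3)] a_def[symmetric])
  qed
  then show ?thesis by blast
qed

section \<open>Almost sure persistence of connectivity\<close>

context gathering_process
begin

lemma space_F [simp]: "space (F k) = space M"
  using filtration.space_F[OF filtration_past] .

lemma sets_F_mono: "j \<le> k \<Longrightarrow> sets (F j) \<subseteq> sets (F k)"
  using filtration.sets_F_mono[OF filtration_past] .

lemma sets_F_events: "E \<in> sets (F k) \<Longrightarrow> E \<in> events"
  using subalgebra_past[of k] by (auto simp: subalgebra_def)

lemma position_measurable_F: "j \<le> k \<Longrightarrow> (\<lambda>\<omega>. p j \<omega> i) \<in> borel_measurable (F k)"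
  by (rule measurable_from_subalg[OF _ position_adapted]) (auto simp: subalgebra_def dest: sets_F_mono)

lemma position_measurable [measurable]: "(\<lambda>\<omega>. p k \<omega> i) \<in> borel_measurable M"
  by (rule measurable_from_subalg[OF subalgebra_past position_adapted])

lemma active_event: "{\<omega> \<in> space M. A k \<omega> = T} \<in> sets (F (Suc k))"
  using measurable_sets[OF active_adapted[of k], of "{T}"]
  by (simp add: vimage_def Collect_conj_eq Int_commute)

abbreviation "G k \<equiv> past_and_active (F k) (A k)"

lemma generators_G: "sets (F k) \<union> {{\<omega> \<in> space (F k). A k \<omega> = T} |T. True} \<subseteq> Pow (space (F k))"
  using sets.sets_into_space[of _ "F k"] by auto

lemma space_G [simp]: "space (G k) = space M"
  unfolding past_and_active_def using generators_G by (subst space_measure_of) auto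

lemma sets_G: "sets (G k) = sigma_sets (space M) (sets (F k) \<union> {{\<omega> \<in> space M. A k \<omega> = T} |T. True})"
  unfolding past_and_active_def using generators_G[of k] by (subst sets_measure_of) auto

lemma subalgebra_G_F: "subalgebra (G k) (F k)"
  unfolding subalgebra_def sets_G by auto

lemma subalgebra_M_G: "subalgebra M (G k)"
proof -
  have "sets (G k) \<subseteq> events"
    unfolding sets_G
  proof (rule sets.sigma_sets_subset)
    show "sets (F k) \<union> {{\<omega> \<in> space M. A k \<omega> = T} |T. True} \<subseteq> events"
      using sets_F_events[of _ k] sets_F_events[OF active_event[of k]] by blast
  qed
  then show ?thesis by (simp add: subalgebra_def)
qed

lemma active_measurable_G [measurable]: "A k \<in> measurable (G k) (count_space UNIV)"
proof (rule measurable_count_space_eq2[THEN iffD2])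
  show "A k \<in> space (G k) \<rightarrow> UNIV \<and> (\<forall>T\<in>UNIV. A k -` {T} \<inter> space (G k) \<in> sets (G k))"
  proof (intro conjI ballI)
    fix T :: "'a set"
    have "A k -` {T} \<inter> space (G k) = {\<omega> \<in> space M. A k \<omega> = T}" by auto
    then show "A k -` {T} \<inter> space (G k) \<in> sets (G k)" unfolding sets_G by auto
  qed auto
qed simp

lemma position_measurable_G [measurable]: "(\<lambda>\<omega>. p k \<omega> i) \<in> borel_measurable (G k)"
  by (rule measurable_from_subalg[OF subalgebra_G_F position_adapted])

abbreviation move_prob :: "nat \<Rightarrow> 'a \<Rightarrow> point set \<Rightarrow> 'w \<Rightarrow> real" where
  "move_prob k i B \<equiv> real_cond_exp M (G k) (indicat_real {\<omega> \<in> space M. p (Suc k) \<omega> i \<in> B})"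

lemma move_event: "B \<in> sets borel \<Longrightarrow> {\<omega> \<in> space M. p k \<omega> i \<in> B} \<in> events"
  using measurable_sets[OF position_measurable, of B k i] by (simp add: vimage_def Int_def conj_commute)

lemma AE_not_null_move:
  assumes B: "B \<in> sets borel"
  shows "AE \<omega> in M. i \<in> A k \<omega> \<and> measure (step_distribution V \<sigma> (p k \<omega>) i) B = 0 \<longrightarrow> p (Suc k) \<omega> i \<notin> B"
proof -
  \<comment> \<open>The vanishing of the law is expressed through \<open>move_prob\<close>, which
    makes \<open>D\<close> an event of \<open>G k\<close>; \<open>active_move\<close> identifies the
    two almost surely.\<close>
  define D where "D = {\<omega> \<in> space (G k). i \<in> A k \<omega> \<and> move_prob k i B \<omega> = 0}"
  let ?H = "{\<omega> \<in> space M. p (Suc k) \<omega> i \<in> B}"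
  have D: "D \<in> sets (G k)" unfolding D_def by measurable
  have DM: "D \<in> events" using D subalgebra_M_G[of k] by (auto simp: subalgebra_def)
  have "prob (D \<inter> ?H) \<le> 0 * prob D"
    by (rule prob_Int_le_cond_exp[OF subalgebra_M_G D move_event[OF B]]) (simp add: D_def)
  then have "prob (D \<inter> ?H) = 0" by (simp add: measure_le_0_iff)
  then have "AE \<omega> in M. \<omega> \<notin> D \<inter> ?H"
    using prob_eq_0[OF sets.Int[OF DM move_event[OF B]]] by blast
  then show ?thesis
    using active_move[OF B, of i k] AE_space
    by eventually_elim (auto simp: D_def)
qed

text \<open>The complement of the closed region is a union of sets from a countable basis, each null
  for the step law. Countably many applications of \<open>AE_not_null_move\<close> therefore suffice
  although the region is random.\<close>

lemma AE_move_allowed: "AE \<omega> in M. p (Suc k) \<omega> i \<in> allowable_region V \<sigma> (p k \<omega>) i"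
proof -
  obtain \<B> :: "point set set" where \<B>: "countable \<B>" "topological_basis \<B>"
    using ex_countable_basis by blast
  have borel: "B \<in> sets borel" if "B \<in> \<B>" for B
    using topological_basis_open[OF \<B>(2) that] by simp
  have "AE \<omega> in M. \<forall>B\<in>\<B>. i \<in> A k \<omega> \<and> measure (step_distribution V \<sigma> (p k \<omega>) i) B = 0
      \<longrightarrow> p (Suc k) \<omega> i \<notin> B"
    using AE_not_null_move borel by (subst AE_ball_countable[OF \<B>(1)]) blast
  with inactive_stay[of i k] show ?thesis
  proof eventually_elim
    case (elim \<omega>)
    let ?R = "allowable_region V \<sigma> (p k \<omega>) i"
    show ?case
    proof (cases "i \<in> A k \<omega>")
      case True
      show ?thesis
      proof (rule ccontr)
        assume "p (Suc k) \<omega> i \<notin> ?R"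
        then have "p (Suc k) \<omega> i \<in> - ?R" by simp
        then obtain B where B: "B \<in> \<B>" "p (Suc k) \<omega> i \<in> B" "B \<subseteq> - ?R"
          by (rule topological_basisE[OF \<B>(2) open_Compl[OF closed_allowable_region]])
        have "measure (step_distribution V \<sigma> (p k \<omega>) i) B = 0"
          by (rule step_distribution_disjoint[OF V_pos \<sigma>_pos borel[OF B(1)]]) (use B(3) in blast)
        with elim(2) True B show False by blast
      qed
    next
      case False
      with elim(1) show ?thesis using self_in_allowable_region[OF V_pos \<sigma>_pos] by metis
    qed
  qed
qed

text \<open>Without the sphere being null, two collocated agents could jump to antipodal points at distance
  exactly \<open>V\<close> and lose each other. The sphere has a random centre, so it is covered by thin annuli
  around points of a countable dense set.\<close>

lemma AE_move_not_on_sphere: "AE \<omega> in M. norm (p (Suc k) \<omega> i - p k \<omega> i) \<noteq> V / 2"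
proof -
  obtain Q :: "point set" where Q: "countable Q" "\<And>X. open X \<Longrightarrow> X \<noteq> {} \<Longrightarrow> \<exists>q\<in>Q. q \<in> X"
    using countable_dense_setE by blast
  define ann :: "point \<times> nat \<Rightarrow> point set" where
    "ann = (\<lambda>(q, m). cball q (V / 2 + 1 / Suc m) - ball q (V / 2 - 1 / Suc m))"
  have ann [measurable]: "ann n \<in> sets borel" for n by (auto simp: ann_def split: prod.split)
  let ?I = "Q \<times> (UNIV :: nat set)"
  define S where "S = {\<omega> \<in> space M. norm (p (Suc k) \<omega> i - p k \<omega> i) = V / 2}"
  have S: "S \<in> events" unfolding S_def by measurable
  have small: "prob S \<le> c" if c: "c > 0" for c
  proof -
    \<comment> \<open>On this event the sphere about \<open>p k \<omega> i\<close> lies in the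
      annulus about the fixed point \<open>fst n\<close>, and a move into that annulus is
      unlikely.\<close>
    define C where "C n = {\<omega> \<in> space (G k). dist (p k \<omega> i) (fst n) < 1 / Suc (snd n)
        \<and> move_prob k i (ann n) \<omega> \<le> c}" for n
    have C: "C n \<in> sets (G k)" for n unfolding C_def by measurable
    have I: "countable ?I" using Q by simp
    define U where "U = (\<Union>n\<in>?I. C n)"
    have U: "U \<in> sets (G k)" unfolding U_def using C I by (intro sets.countable_UN'') auto
    have UM: "U \<in> events" using U subalgebra_M_G[of k] by (auto simp: subalgebra_def)
    have "1 * prob (U \<inter> S) \<le> c * prob (U \<inter> space M)"
    proof (rule prob_Int_mono_countable_cover[OF subalgebra_M_G U I C _ S])
      fix n D assume D: "D \<in> sets (G k)" "D \<subseteq> C n"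
      have DM: "D \<in> events" using D subalgebra_M_G[of k] by (auto simp: subalgebra_def)
      have "D \<inter> S \<subseteq> D \<inter> {\<omega> \<in> space M. p (Suc k) \<omega> i \<in> ann n}"
      proof
        fix \<omega> assume \<omega>: "\<omega> \<in> D \<inter> S"
        obtain q m where n: "n = (q, m)" by (cases n)
        have near: "dist (p k \<omega> i) q < 1 / Suc m" using \<omega> D n by (auto simp: C_def)
        have sph: "dist (p (Suc k) \<omega> i) (p k \<omega> i) = V / 2" "\<omega> \<in> space M"
          using \<omega> by (auto simp: S_def dist_norm)
        have "dist q (p (Suc k) \<omega> i) \<le> V / 2 + 1 / Suc m"
          using near sph dist_triangle[of q "p (Suc k) \<omega> i" "p k \<omega> i"] by (simp add: dist_commute)
        moreover have "V / 2 - 1 / Suc m \<le> dist q (p (Suc k) \<omega> i)"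
          using near sph dist_triangle[of "p (Suc k) \<omega> i" "p k \<omega> i" q] by (simp add: dist_commute)
        ultimately show "\<omega> \<in> D \<inter> {\<omega> \<in> space M. p (Suc k) \<omega> i \<in> ann n}"
          using \<omega> sph by (simp add: ann_def n)
      qed
      then have "prob (D \<inter> S) \<le> prob (D \<inter> {\<omega> \<in> space M. p (Suc k) \<omega> i \<in> ann n})"
        using DM by (intro finite_measure_mono sets.Int move_event) auto
      also have "\<dots> \<le> c * prob D"
        by (rule prob_Int_le_cond_exp[OF subalgebra_M_G D(1) move_event[OF ann]])
           (use D(2) in \<open>auto simp: C_def\<close>)
      finally show "1 * prob (D \<inter> S) \<le> c * prob (D \<inter> space M)"
        using sets.sets_into_space[OF DM] by (simp add: Int_absorb2)
    qed (auto simp: U_def)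
    also have "\<dots> \<le> c" using c by (simp add: mult_left_le)
    finally have US: "prob (U \<inter> S) \<le> c" by simp
    have "AE \<omega> in M. \<forall>n\<in>?I. i \<in> A k \<omega> \<longrightarrow> move_prob k i (ann n) \<omega>
        = measure (step_distribution V \<sigma> (p k \<omega>) i) (ann n)"
      using active_move[OF ann] by (subst AE_ball_countable[OF I]) blast
    with inactive_stay[of i k] AE_move_allowed[of k i]
    \<comment> \<open>A step of length \<open>V / 2\<close> is a proper move, so the agent is active
      and its region is no singleton; \<open>step_distribution_thin_annulus\<close> supplies
      \<open>m\<close>, then density supplies \<open>q\<close>.\<close>
    have "AE \<omega> in M. \<omega> \<in> S \<longrightarrow> \<omega> \<in> U \<inter> S"
    proof eventually_elim
      case (elim \<omega>)
      show ?case
      proof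
        assume \<omega>: "\<omega> \<in> S"
        then have moved: "p (Suc k) \<omega> i \<noteq> p k \<omega> i" using V_pos by (auto simp: S_def)
        then have act: "i \<in> A k \<omega>" and ns: "allowable_region V \<sigma> (p k \<omega>) i \<noteq> {p k \<omega> i}"
          using elim by auto
        obtain m where m: "\<And>q. measure (step_distribution V \<sigma> (p k \<omega>) i) (ann (q, m)) \<le> c"
          using step_distribution_thin_annulus[OF V_pos c ns] by (auto simp: ann_def)
        obtain q where q: "q \<in> Q" "q \<in> ball (p k \<omega> i) (1 / Suc m)"
          using Q(2)[of "ball (p k \<omega> i) (1 / Suc m)"] by auto
        have "\<omega> \<in> C (q, m)"
          using \<omega> q m[of q] elim(3) act by (auto simp: C_def S_def)
        then show "\<omega> \<in> U \<inter> S" using q \<omega> by (auto simp: U_def)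
      qed
    qed
    then have "prob S \<le> prob (U \<inter> S)" using UM S by (intro finite_measure_mono_AE) auto
    with US show ?thesis by simp
  qed
  have "prob S \<le> 0" by (rule field_le_epsilon) (use small in simp)
  then have "prob S = 0" by (simp add: measure_le_0_iff)
  then have "AE \<omega> in M. \<omega> \<notin> S" using S by (simp add: prob_eq_0)
  then show ?thesis using AE_space by eventually_elim (auto simp: S_def)
qed

lemma AE_connected:
  assumes "AE \<omega> in M. connected_constellation V (p 0 \<omega>)"
  shows "AE \<omega> in M. connected_constellation V (p k \<omega>)"
proof (induction k)
  case (Suc k)
  have "AE \<omega> in M. \<forall>i. p (Suc k) \<omega> i \<in> allowable_region V \<sigma> (p k \<omega>) i"
    "AE \<omega> in M. \<forall>i. norm (p (Suc k) \<omega> i - p k \<omega> i) \<noteq> V / 2"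
    using AE_move_allowed AE_move_not_on_sphere by (auto simp: AE_all_countable)
  with Suc show ?case
    by eventually_elim (rule connected_step[OF V_pos], auto)
qed (use assms in simp)

section \<open>Drops of the potential and geometric tails\<close>

text \<open>Once some agent has all others within \<open>V / 2\<close>, nothing more has to be shown; counting this as
  a drop keeps the lower bound on its probability unconditional.\<close>

definition drop :: "real \<Rightarrow> nat \<Rightarrow> 'w set" where
  "drop c k = {\<omega> \<in> space M. centred V (p k \<omega>) \<or> potential (p (Suc k) \<omega>) \<le> potential (p k \<omega>) - c}"

text \<open>Says that the first centred time, which bounds the gathering time, exceeds
  \<open>k\<close>.\<close>

definition alive :: "nat \<Rightarrow> 'w set" where
  "alive k = {\<omega> \<in> space M. \<forall>j\<le>k. \<not> centred V (p j \<omega>)}"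

lemma sets_drop: "drop c k \<in> sets (F (Suc k))"
proof -
  note [measurable] = position_measurable_F[of k "Suc k"] position_measurable_F[of "Suc k" "Suc k"]
  have "{\<omega> \<in> space (F (Suc k)). centred V (p k \<omega>) \<or> potential (p (Suc k) \<omega>) \<le> potential (p k \<omega>) - c}
      \<in> sets (F (Suc k))"
    unfolding centred_def potential_def by measurable
  then show ?thesis by (simp add: drop_def)
qed

lemma sets_alive: "alive k \<in> sets (F k)"
proof -
  have "{\<omega> \<in> space (F k). centred V (p j \<omega>)} \<in> sets (F k)" if "j \<le> k" for j
  proof -
    note [measurable] = position_measurable_F[OF that]
    show ?thesis unfolding centred_def by measurable
  qed
  then have "space (F k) - (\<Union>j\<in>{..k}. {\<omega> \<in> space (F k). centred V (p j \<omega>)}) \<in> sets (F k)"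
    by (intro sets.Diff sets.finite_UN sets.top) auto
  moreover have "space (F k) - (\<Union>j\<in>{..k}. {\<omega> \<in> space (F k). centred V (p j \<omega>)}) = alive k"
    by (auto simp: alive_def)
  ultimately show ?thesis by simp
qed

text \<open>Two conditionings are chained: given the past, the corner agent alone is active with
  probability at least \<open>\<delta>\<close>; given also the active set, it lands in a ball of
  good targets with probability at least \<open>\<epsilon>\<close>. Direction, corner and target
  vary with the outcome, so this is done on countably many pieces of the past.\<close>

lemma drop_probability:
  obtains \<eta> c :: real where "\<eta> > 0" "c > 0"
    "\<And>k E. E \<in> sets (F k) \<Longrightarrow> \<eta> * prob E \<le> prob (E \<inter> drop c k)"
proof -
  obtain \<kappa> and W :: "point set" where W: "\<kappa> > 0" "\<kappa> \<le> 1" "finite W" "\<And>b. b \<in> W \<Longrightarrow> norm b = 1"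
    "\<And>x :: 'a \<Rightarrow> point. \<exists>b\<in>W. \<exists>i. \<forall>j. \<kappa> * norm (x j - x i) \<le> b \<bullet> (x j - x i)"
    using transversal_directions[where 'a='a] by blast
  obtain \<delta> where \<delta>: "\<delta> > 0" "\<And>S k. AE \<omega> in M.
      \<delta> \<le> real_cond_exp M (F k) (indicat_real {\<omega>' \<in> space M. A k \<omega>' = S}) \<omega>"
    using strong_asynchronicity by blast
  obtain Q :: "point set" where Q: "countable Q" "\<And>X. open X \<Longrightarrow> X \<noteq> {} \<Longrightarrow> \<exists>q\<in>Q. q \<in> X"
    using countable_dense_setE by blast
  \<comment> \<open>\<open>t\<close> meets the length limits of \<open>corner_move_allowed\<close>
    and \<open>corner_move_potential\<close>. Their tolerance \<open>t * \<kappa> / 4\<close> equals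
    \<open>2 * r\<close>: one \<open>r\<close> for approximating the ideal target by
    \<open>q\<close>, one for the landing point in the ball about \<open>q\<close>.\<close>
  define t where "t = min (\<kappa> * V / (4 * real CARD('a))) (\<sigma> / 2)"
  define r where "r = t * \<kappa> / 8"
  define c where "c = t * \<kappa> * V / 2"
  define \<epsilon> where "\<epsilon> = (2 * r / V)\<^sup>2"
  have card: "real CARD('a) \<ge> 1" by (simp add: Suc_leI)
  have t: "t > 0" "t \<le> \<kappa> * V / (4 * real CARD('a))" "t \<le> \<sigma> / 2"
    using W V_pos \<sigma>_pos by (auto simp: t_def)
  have "\<kappa> * V / (4 * real CARD('a)) \<le> \<kappa> * V / 4"
    using card W V_pos by (intro divide_left_mono) auto
  with t have t': "t \<le> \<kappa> * V / 4" by linarith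
  have r: "r > 0" and c: "c > 0" and \<epsilon>: "\<epsilon> > 0" using t W V_pos by (auto simp: r_def c_def \<epsilon>_def)
  let ?I = "W \<times> (UNIV :: 'a set) \<times> Q"
  have I: "countable ?I" using Q W by (auto intro: countable_finite)
  define C where "C = (\<lambda>k (b, i, q). {\<omega> \<in> space (F k).
      (\<forall>j. \<kappa> * norm (p k \<omega> j - p k \<omega> i) \<le> b \<bullet> (p k \<omega> j - p k \<omega> i)) \<and> norm (q - p k \<omega> i - t *\<^sub>R b) < r})"
  have C: "C k n \<in> sets (F k)" for k n
  proof -
    note [measurable] = position_measurable_F[of k k, OF order_refl]
    obtain b i q where n: "n = (b, i, q)" by (cases n)
    show ?thesis unfolding n C_def prod.case by measurable
  qed
  have bound: "\<epsilon> * \<delta> * prob D \<le> prob (D \<inter> drop c k)"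
    if n: "n \<in> ?I" and D: "D \<in> sets (F k)" "D \<subseteq> C k n" for k n D
  proof -
    obtain b i q where n: "n = (b, i, q)" "b \<in> W" using n by auto
    let ?S = "{\<omega> \<in> space M. A k \<omega> = {i}}"
    let ?H = "{\<omega> \<in> space M. p (Suc k) \<omega> i \<in> ball q r}"
    have inC: "\<kappa> * norm (p k \<omega> j - p k \<omega> i) \<le> b \<bullet> (p k \<omega> j - p k \<omega> i)"
      "norm (q - p k \<omega> i - t *\<^sub>R b) < r" if "\<omega> \<in> D" for \<omega> j
      using that D by (auto simp: C_def n)
    have near: "norm (y - p k \<omega> i - t *\<^sub>R b) \<le> t * \<kappa> / 4" if "\<omega> \<in> D" "y \<in> ball q r" for \<omega> y
    proof -
      have "norm (y - p k \<omega> i - t *\<^sub>R b) \<le> norm (y - q) + norm (q - p k \<omega> i - t *\<^sub>R b)"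
        using norm_triangle_ineq[of "y - q" "q - p k \<omega> i - t *\<^sub>R b"] by (simp add: algebra_simps)
      then show ?thesis
        using inC(2)[OF that(1)] that(2) by (simp add: dist_norm norm_minus_commute r_def)
    qed
    have S: "?S \<in> events" using active_event[of k "{i}"] sets_F_events by blast
    have "D \<inter> ?S \<in> sets (G k)"
    proof -
      have "D \<in> sets (G k)" using D subalgebra_G_F[of k] by (auto simp: subalgebra_def)
      moreover have "{\<omega> \<in> space (G k). A k \<omega> = {i}} \<in> sets (G k)" by measurable
      ultimately show ?thesis by (simp add: sets.Int)
    qed
    note DS = this
    have "\<epsilon> * (\<delta> * prob D) \<le> \<epsilon> * prob (D \<inter> ?S)"
    proof (rule mult_left_mono)
      show "\<delta> * prob D \<le> prob (D \<inter> ?S)"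
        by (rule prob_Int_ge_cond_exp[OF subalgebra_past D(1) S]) (use \<delta>(2)[of k "{i}"] in \<open>eventually_elim, simp\<close>)
    qed (use \<epsilon> in simp)
    also have "\<dots> \<le> prob ((D \<inter> ?S) \<inter> ?H)"
    proof (rule prob_Int_ge_cond_exp[OF subalgebra_M_G DS])
      show "AE \<omega> in M. \<omega> \<in> D \<inter> ?S \<longrightarrow> \<epsilon> \<le> move_prob k i (ball q r) \<omega>"
        using active_move[of "ball q r" i k, OF borel_open[OF open_ball]]
      proof eventually_elim
        case (elim \<omega>)
        show ?case
        proof
          assume \<omega>: "\<omega> \<in> D \<inter> ?S"
          have "ball q r \<subseteq> allowable_region V \<sigma> (p k \<omega>) i"
          proof
            fix y assume y: "y \<in> ball q r"
            have "\<omega> \<in> D" using \<omega> by simp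
            note bounds = inC(1)[OF this] near[OF this y]
            have "p k \<omega> i + (y - p k \<omega> i) \<in> allowable_region V \<sigma> (p k \<omega>) i"
              by (rule corner_move_allowed[OF V_pos W(1,2) W(4)[OF n(2)] t(1) t' t(3)]) (rule bounds)+
            then show "y \<in> allowable_region V \<sigma> (p k \<omega>) i" by simp
          qed
          then show "\<epsilon> \<le> move_prob k i (ball q r) \<omega>"
            using step_distribution_ball_ge[OF V_pos r] elim \<omega> by (auto simp: \<epsilon>_def)
        qed
      qed
    qed (rule move_event, simp)
    also have "\<dots> \<le> prob (D \<inter> drop c k)"
    proof (rule finite_measure_mono_AE)
      have "AE \<omega> in M. \<forall>j. j \<notin> A k \<omega> \<longrightarrow> p (Suc k) \<omega> j = p k \<omega> j"
        using inactive_stay by (simp add: AE_all_countable)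
      then show "AE \<omega> in M. \<omega> \<in> (D \<inter> ?S) \<inter> ?H \<longrightarrow> \<omega> \<in> D \<inter> drop c k"
      proof eventually_elim
        case (elim \<omega>)
        show ?case
        proof
          assume \<omega>: "\<omega> \<in> (D \<inter> ?S) \<inter> ?H"
          then have "\<omega> \<in> D" "p (Suc k) \<omega> i \<in> ball q r" by auto
          note bounds = inC(1)[OF this(1)] near[OF this]
          \<comment> \<open>Only \<open>i\<close> is active, so all other agents stay.\<close>
          have "p (Suc k) \<omega> = (p k \<omega>)(i := p k \<omega> i + (p (Suc k) \<omega> i - p k \<omega> i))"
            using elim \<omega> by (auto simp: fun_eq_iff)
          moreover have "potential ((p k \<omega>)(i := p k \<omega> i + (p (Suc k) \<omega> i - p k \<omega> i)))
              \<le> potential (p k \<omega>) - c" if "\<not> centred V (p k \<omega>)"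
            unfolding c_def
            by (rule corner_move_potential[OF V_pos W(1,2) W(4)[OF n(2)] t(1,2) _ _ that]) (rule bounds)+
          ultimately show "\<omega> \<in> D \<inter> drop c k" using \<omega> by (auto simp: drop_def)
        qed
      qed
      show "D \<inter> drop c k \<in> events" using D sets_drop sets_F_events by blast
    qed
    finally show ?thesis by (simp add: mult.assoc)
  qed
  show ?thesis
  proof (rule that[of "\<epsilon> * \<delta>" c])
    show "\<epsilon> * \<delta> > 0" using \<epsilon> \<delta> by simp
    show "c > 0" by (rule c)
    fix k E assume E: "E \<in> sets (F k)"
    have "E \<subseteq> (\<Union>n\<in>?I. C k n)"
    proof
      fix \<omega> assume "\<omega> \<in> E"
      then have \<omega>: "\<omega> \<in> space (F k)" using sets.sets_into_space[OF E] by blast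
      obtain b i where bi: "b \<in> W" "\<forall>j. \<kappa> * norm (p k \<omega> j - p k \<omega> i) \<le> b \<bullet> (p k \<omega> j - p k \<omega> i)"
        using W(5)[of "p k \<omega>"] by blast
      obtain q where q: "q \<in> Q" "q \<in> ball (p k \<omega> i + t *\<^sub>R b) r"
        using Q(2)[of "ball (p k \<omega> i + t *\<^sub>R b) r"] r by auto
      have "norm (q - p k \<omega> i - t *\<^sub>R b) < r"
        using q(2) by (simp add: dist_norm norm_minus_commute diff_diff_eq)
      then have "\<omega> \<in> C k (b, i, q)" using bi \<omega> by (simp add: C_def)
      then show "\<omega> \<in> (\<Union>n\<in>?I. C k n)" using bi(1) q(1) by blast
    qed
    then have "\<epsilon> * \<delta> * prob (E \<inter> space M) \<le> 1 * prob (E \<inter> drop c k)"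
      using bound sets_F_events[OF sets_drop] sets.sets_into_space[OF sets_F_events]
      by (intro prob_Int_mono_countable_cover[OF subalgebra_past E I C]) (auto simp: Int_absorb2)
    then show "\<epsilon> * \<delta> * prob E \<le> prob (E \<inter> drop c k)"
      using sets.sets_into_space[OF sets_F_events[OF E]] by (simp add: Int_absorb2)
  qed
qed

text \<open>The drops so far form an event of the past of the next step, so \<open>drop\<close>
  applies to them again and the factors multiply.\<close>

lemma prob_repeated_drops:
  assumes "\<eta> > 0" and drop: "\<And>k E. E \<in> sets (F k) \<Longrightarrow> \<eta> * prob E \<le> prob (E \<inter> drop c k)"
    and E: "E \<in> sets (F k)"
  shows "E \<inter> (\<Inter>j<N. drop c (k + j)) \<in> sets (F (k + N))
    \<and> \<eta> ^ N * prob E \<le> prob (E \<inter> (\<Inter>j<N. drop c (k + j)))"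
proof (induction N)
  case (Suc N)
  let ?E = "E \<inter> (\<Inter>j<N. drop c (k + j))"
  have eq: "E \<inter> (\<Inter>j<Suc N. drop c (k + j)) = ?E \<inter> drop c (k + N)"
    by (auto simp: less_Suc_eq)
  have "\<eta> * (\<eta> ^ N * prob E) \<le> \<eta> * prob ?E" using Suc assms(1) by (intro mult_left_mono) auto
  also have "\<dots> \<le> prob (?E \<inter> drop c (k + N))" using Suc by (intro drop) auto
  finally have "\<eta> ^ Suc N * prob E \<le> prob (?E \<inter> drop c (k + N))" by simp
  moreover have "?E \<inter> drop c (k + N) \<in> sets (F (k + Suc N))"
    using Suc sets_drop[of c "k + N"] sets_F_mono[of "k + N" "k + Suc N"] by auto
  ultimately show ?case unfolding eq by blast
qed (use E in simp)

lemma prob_alive_contraction: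
  assumes "AE \<omega> in M. connected_constellation V (p 0 \<omega>)"
  obtains N :: nat and \<theta> :: real
  where "\<theta> < 1" "\<theta> \<ge> 0" "\<And>k. prob (alive (k + N)) \<le> \<theta> * prob (alive k)"
proof -
  obtain \<eta> c where \<eta>: "\<eta> > 0" "c > 0"
    "\<And>k E. E \<in> sets (F k) \<Longrightarrow> \<eta> * prob E \<le> prob (E \<inter> drop c k)"
    using drop_probability by blast
  define K where "K = (real CARD('a))\<^sup>2 * (real CARD('a \<times> 'a) * V)\<^sup>2"
  \<comment> \<open>\<open>N\<close> drops by \<open>c\<close> would push a potential of at most
    \<open>K\<close> below zero.\<close>
  obtain N :: nat where N: "K < real N * c"
    using reals_Archimedean3[OF \<eta>(2)] by blast
  have "\<eta> \<le> 1"
  proof -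
    have "\<eta> * prob (space M) \<le> prob (space M \<inter> drop c 0)"
      by (rule \<eta>(3)) (metis sets.top space_F)
    also have "\<dots> \<le> 1" by simp
    finally show ?thesis by (simp add: prob_space)
  qed
  then have \<eta>N: "\<eta> ^ N \<le> 1" "\<eta> ^ N > 0" using \<eta>(1) by (auto intro: power_le_one)
  have "prob (alive (k + N)) \<le> (1 - \<eta> ^ N) * prob (alive k)" for k
  proof -
    let ?D = "alive k \<inter> (\<Inter>j<N. drop c (k + j))"
    have rep: "?D \<in> sets (F (k + N))" "\<eta> ^ N * prob (alive k) \<le> prob ?D"
      using prob_repeated_drops[OF \<eta>(1,3) sets_alive[of k], of N] by auto
    have ev: "?D \<in> events" "alive k \<in> events" using rep sets_F_events sets_alive by blast+
    \<comment> \<open>Being alive at \<open>k + N\<close> excludes \<open>N\<close> drops in a row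
      from \<open>k\<close> on: none of them could hold through its \<open>centred\<close>
      alternative, so each would be a true decrease.\<close>
    have "AE \<omega> in M. \<omega> \<in> alive (k + N) \<longrightarrow> \<omega> \<in> alive k - ?D"
      using AE_connected[OF assms, of k]
    proof eventually_elim
      case (elim \<omega>)
      have "False" if \<omega>: "\<omega> \<in> alive (k + N)" "\<omega> \<in> ?D"
      proof -
        have "potential (p (k + j) \<omega>) \<le> K - real j * c" if "j \<le> N" for j
          using that
        proof (induction j)
          case 0
          then show ?case using connected_potential_le[OF elim V_pos] by (simp add: K_def)
        next
          case (Suc j)
          then have "\<omega> \<in> drop c (k + j)" "\<not> centred V (p (k + j) \<omega>)"
            using \<omega> by (auto simp: alive_def)
          then show ?case using Suc by (auto simp: drop_def algebra_simps)
        qed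
        from this[of N] N potential_nonneg[of "p (k + N) \<omega>"] show False by simp
      qed
      moreover have "alive (k + N) \<subseteq> alive k" by (auto simp: alive_def)
      ultimately show ?case by blast
    qed
    then have "prob (alive (k + N)) \<le> prob (alive k - ?D)"
      using ev by (intro finite_measure_mono_AE) auto
    also have "\<dots> = prob (alive k) - prob ?D" using ev by (intro finite_measure_Diff) auto
    finally show ?thesis using rep(2) by (simp add: algebra_simps)
  qed
  then show ?thesis using \<eta>N by (intro that[of "1 - \<eta> ^ N" N]) auto
qed

text \<open>\<open>alive k\<close> holds exactly for \<open>k\<close> below the first centred time,
  so the sum of the indicators is this time, or infinite if there is none.\<close>

lemma gathering_time_le: "\<omega> \<in> space M \<Longrightarrow> gathering_time V p \<omega> \<le> (\<Sum>k. indicator (alive k) \<omega>)"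
proof (cases "\<exists>k. centred V (p k \<omega>)")
  case True
  assume \<omega>: "\<omega> \<in> space M"
  define m where "m = (LEAST k. centred V (p k \<omega>))"
  have m: "centred V (p m \<omega>)" "\<And>k. k < m \<Longrightarrow> \<not> centred V (p k \<omega>)"
    using True LeastI_ex[of "\<lambda>k. centred V (p k \<omega>)"] not_less_Least by (auto simp: m_def)
  have "gathering_time V p \<omega> \<le> of_nat m"
    unfolding gathering_time_def using centred_imp_gathered[OF m(1)] by (intro INF_lower) simp
  also have "\<dots> = (\<Sum>k<m. indicator (alive k) \<omega>)"
    using m(2) \<omega> by (simp add: alive_def indicator_def)
  also have "\<dots> \<le> (\<Sum>k. indicator (alive k) \<omega>)" by (intro sum_le_suminf) auto
  finally show ?thesis .
next
  case False
  assume "\<omega> \<in> space M"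
  then have "indicator (alive k) \<omega> = (1 :: ennreal)" for k using False by (simp add: alive_def)
  then have "of_nat n \<le> (\<Sum>k. indicator (alive k) \<omega> :: ennreal)" for n
    using sum_le_suminf[of "\<lambda>k. indicator (alive k) \<omega> :: ennreal" "{..<n}"] by simp
  then have "(\<Sum>k. indicator (alive k) \<omega>) = (top :: ennreal)"
    by (metis ennreal_Ex_less_of_nat less_top not_le)
  then show ?thesis by simp
qed

end

text \<open>Shifting by \<open>N\<close> gives
  \<open>s \<le> (\<Sum>k<N. a k) + \<theta> * s\<close> for every partial sum \<open>s\<close>,
  which can be solved for \<open>s\<close>.\<close>

lemma summable_periodic_contraction:
  fixes a :: "nat \<Rightarrow> real"
  assumes "\<And>k. 0 \<le> a k" "0 \<le> \<theta>" "\<theta> < 1" and step: "\<And>k. a (k + N) \<le> \<theta> * a k"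
  shows "summable a"
proof (rule summableI_nonneg_bounded)
  define B where "B = (\<Sum>k<N. a k) / (1 - \<theta>)"
  show "(\<Sum>k<n. a k) \<le> B" for n
  proof -
    let ?s = "\<Sum>k<n. a k"
    have "?s \<le> (\<Sum>k<N + n. a k)" using assms(1) by (intro sum_mono2) auto
    also have "\<dots> = (\<Sum>k<N. a k) + (\<Sum>k<n. a (k + N))"
      by (induction n) (auto simp: add.commute)
    also have "(\<Sum>k<n. a (k + N)) \<le> \<theta> * ?s"
      unfolding sum_distrib_left by (intro sum_mono step)
    finally show ?thesis using assms(3) by (simp add: B_def field_simps)
  qed
qed (use assms in auto)

theorem theorem9:
  fixes M :: "'w measure" and F :: "nat \<Rightarrow> 'w measure" and V \<sigma> :: real
    and p :: "nat \<Rightarrow> 'w \<Rightarrow> 'a::finite \<Rightarrow> point" and A :: "nat \<Rightarrow> 'w \<Rightarrow> 'a set"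
    and x\<^sub>0 :: "'a \<Rightarrow> point"
  assumes "gathering_process M F V \<sigma> p A"
    and "AE \<omega> in M. p 0 \<omega> = x\<^sub>0"
    and "connected_constellation V x\<^sub>0"
  shows "(\<integral>\<^sup>+ \<omega>. gathering_time V p \<omega> \<partial>M) < \<infinity>"
proof -
  interpret gathering_process M F V \<sigma> p A by fact
  have "AE \<omega> in M. connected_constellation V (p 0 \<omega>)"
    using assms(2) by eventually_elim (use assms(3) in simp)
  then obtain N \<theta> where "\<theta> < 1" "\<theta> \<ge> 0" "\<And>k. prob (alive (k + N)) \<le> \<theta> * prob (alive k)"
    using prob_alive_contraction by blast
  then have sum: "summable (\<lambda>k. prob (alive k))"
    by (intro summable_periodic_contraction[of _ \<theta> N]) auto
  have alive [measurable]: "alive k \<in> events" for k using sets_F_events[OF sets_alive] .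
  have "(\<integral>\<^sup>+ \<omega>. gathering_time V p \<omega> \<partial>M) \<le> (\<integral>\<^sup>+ \<omega>. (\<Sum>k. indicator (alive k) \<omega>) \<partial>M)"
    by (intro nn_integral_mono gathering_time_le)
  also have "\<dots> = (\<Sum>k. \<integral>\<^sup>+ \<omega>. indicator (alive k) \<omega> \<partial>M)"
    by (intro nn_integral_suminf borel_measurable_indicator alive)
  also have "\<dots> = (\<Sum>k. ennreal (prob (alive k)))" by (simp add: emeasure_eq_measure)
  also have "\<dots> < \<infinity>"
    unfolding infinity_ennreal_def
    by (rule less_top[THEN iffD1, OF ennreal_suminf_neq_top[OF sum measure_nonneg]])
  finally show ?thesis .
qed

end
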